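(* Let $m \geq 1$ and $n \geq 1$ be integers, and let $T_n(m)$ be the number of $m$-ary increasing trees on $n$ vertices. Then \[ T_n(m) = \sum_{k=0}^{n} (-1)^k \, B_{n+k-1,k}\big(\chi_m(K_0,-1), \chi_m(K_1,-1), \ldots, \chi_m(K_{n-1},-1)\big), \] where $\chi_m(K_0,-1) = 0$ and, for every $s \geq 1$, \[ \chi_m(K_s,-1) = \sum_{k=1}^{s} (-1)^k \, k! \, B_{s,k}(1_m). \]
   Context: An increasing tree on $n$ vertices is a rooted tree whose vertex set is $\{1,\ldots,n\}$ (children of a vertex are unordered, i.e. the tree is not embedded in the plane) such that the labels strictly increase along every path from the root to a leaf. It is $m$-ary if every vertex has at most $m$ children. Bell polynomials: for integers $n,k \geq 0$, $B_{n,k}(x_1,x_2,\ldots,x_{n-k+1}) = \sum_{\alpha} \frac{n!}{\alpha_1!\alpha_2!\cdots\alpha_{n-k+1}!}\prod_{i}\left(\frac{x_i}{i!}\right)^{\alpha_i}$, the sum over all sequences $\alpha=(\alpha_1,\ldots,\alpha_{n-k+1})$ of nonnegative integers with $\sum_i \alpha_i = k$ and $\sum_i i\,\alpha_i = n$; in particular $B_{0,0}=1$ and $B_{n,0}=0$ for $n\ge 1$. Extra arguments beyond those needed are ignored. $1_m$ denotes the sequence $(x_1,x_2,\ldots)$ with $x_i = 1$ for $1\le i\le m$ and $x_i=0$ for $i>m$. Degree-chromatic polynomial: for a graph $G$ and positive integer $\lambda$, $\chi_m(G,\lambda)$ is the number of colorings of the vertices of $G$ with $\lambda$ colors such that every vertex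 $v$ has at most $m-1$ neighbors having the same color as $v$; this is a polynomial in $\lambda$, and $\chi_m(G,-1)$ denotes its value at $\lambda=-1$. $K_s$ is the complete graph on $s$ vertices. For the purpose of this statement, the value $\chi_m(K_0,-1)$ is taken to be $0$ (the paper's convention). *)

theory Defs
  imports Complex_Main "HOL-Library.FuncSet" "HOL-Computational_Algebra.Polynomial"
begin

text \<open>A rooted tree is given by its vertex set, its root and the set of its
  (parent, child) pairs; in particular children are unordered.\<close>

definition rooted_tree :: "'a set \<Rightarrow> 'a \<Rightarrow> ('a \<times> 'a) set \<Rightarrow> bool" where
  "rooted_tree V r E \<longleftrightarrow>
     r \<in> V \<and> E \<subseteq> V \<times> V \<and> (\<forall>u. (u, r) \<notin> E) \<and>
     (\<forall>v \<in> V - {r}. \<exists>!u. (u, v) \<in> E) \<and> (\<forall>v \<in> V. (r, v) \<in> E\<^sup>*)"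

definition children :: "('a \<times> 'a) set \<Rightarrow> 'a \<Rightarrow> 'a set" where
  "children E v = {w. (v, w) \<in> E}"

definition root_leaf_path :: "'a \<Rightarrow> ('a \<times> 'a) set \<Rightarrow> 'a list \<Rightarrow> bool" where
  "root_leaf_path r E xs \<longleftrightarrow>
     xs \<noteq> [] \<and> hd xs = r \<and> successively (\<lambda>u v. (u, v) \<in> E) xs \<and> children E (last xs) = {}"

definition increasing_tree :: "nat \<Rightarrow> nat \<Rightarrow> (nat \<times> nat) set \<Rightarrow> bool" where
  "increasing_tree n r E \<longleftrightarrow>
     rooted_tree {1..n} r E \<and> (\<forall>xs. root_leaf_path r E xs \<longrightarrow> sorted_wrt (<) xs)"

definition mary_tree :: "nat \<Rightarrow> 'a set \<Rightarrow> ('a \<times> 'a) set \<Rightarrow> bool" where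
  "mary_tree m V E \<longleftrightarrow> (\<forall>v \<in> V. card (children E v) \<le> m)"

definition num_mary_increasing_trees :: "nat \<Rightarrow> nat \<Rightarrow> nat" where
  "num_mary_increasing_trees m n =
     card {(r, E). increasing_tree n r E \<and> mary_tree m {1..n} E}"

text \<open>The argument \<open>x\<close> is a sequence \<open>x 1, x 2, \<dots>\<close>; the value \<open>x 0\<close> is never used.
  The index bound is written \<open>n + 1 - k\<close> so that the index set is empty for \<open>k > n\<close>.\<close>

definition bell_poly :: "nat \<Rightarrow> nat \<Rightarrow> (nat \<Rightarrow> 'a::field_char_0) \<Rightarrow> 'a" where
  "bell_poly n k x =
     (\<Sum>\<alpha> \<in> {\<alpha> \<in> {1..n+1-k} \<rightarrow>\<^sub>E (UNIV :: nat set).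
               (\<Sum>i=1..n+1-k. \<alpha> i) = k \<and> (\<Sum>i=1..n+1-k. i * \<alpha> i) = n}.
        fact n / (\<Prod>i=1..n+1-k. fact (\<alpha> i)) * (\<Prod>i=1..n+1-k. (x i / fact i) ^ \<alpha> i))"

definition ones_upto :: "nat \<Rightarrow> nat \<Rightarrow> 'a::field_char_0" where
  "ones_upto m i = (if 1 \<le> i \<and> i \<le> m then 1 else 0)"

text \<open>A simple graph is a pair of a vertex set and a set of two-element sets of vertices.\<close>

type_synonym 'a graph = "'a set \<times> 'a set set"

definition complete_graph :: "nat \<Rightarrow> nat graph" where
  "complete_graph s = ({1..s}, {{u, v} | u v. u \<in> {1..s} \<and> v \<in> {1..s} \<and> u \<noteq> v})"

definition neighbors :: "'a graph \<Rightarrow> 'a \<Rightarrow> 'a set" where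
  "neighbors G v = {u \<in> fst G. {u, v} \<in> snd G}"

definition degree_colorings :: "nat \<Rightarrow> 'a graph \<Rightarrow> nat \<Rightarrow> ('a \<Rightarrow> nat) set" where
  "degree_colorings m G l =
     {c \<in> fst G \<rightarrow>\<^sub>E {1..l}. \<forall>v \<in> fst G. card {u \<in> neighbors G v. c u = c v} \<le> m - 1}"

definition degree_chromatic_poly :: "nat \<Rightarrow> 'a graph \<Rightarrow> real poly" where
  "degree_chromatic_poly m G =
     (THE p. \<forall>l::nat. l \<ge> 1 \<longrightarrow> poly p (real l) = real (card (degree_colorings m G l)))"

text \<open>The value at \<open>-1\<close> of the degree-chromatic polynomial of the complete graph on \<open>s\<close>
  vertices, except that the value for \<open>s = 0\<close> is \<open>0\<close> by convention (the
  polynomial itself would be the constant \<open>1\<close>).\<close>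

definition chi_complete :: "nat \<Rightarrow> nat \<Rightarrow> real" where
  "chi_complete m s = (if s = 0 then 0 else poly (degree_chromatic_poly m (complete_graph s)) (-1))"

end

theory Submission
  imports Defs "HOL-Computational_Algebra.Formal_Power_Series"
begin

text \<open>Let \<open>\<phi>\<close> be the exponential series truncated after degree \<open>m\<close>, and weight a tree by the
  product over its vertices of the derivatives of \<open>\<phi>\<close> of order the number of children. Growing
  increasing trees by attaching a new largest leaf acts on the total weight as the operator
  \<open>\<phi> D\<close>, and the constant term of a weight is 1 or 0 according to whether the tree is
  \<open>m\<close>-ary; hence \<open>T\<^sub>n(m)\<close> is the constant term of \<open>(\<phi> D)\<^sup>n X\<close>.
  On the other hand the colourings of \<open>K\<^sub>s\<close> with \<open>l\<close> colours are counted by \<open>\<phi>\<^sup>l\<close>, so the values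
  at \<open>-1\<close> are the coefficients of \<open>1 / \<phi>\<close>. Thus \<open>\<phi> D\<close> is differentiation with respect to
  \<open>X + H\<close>, where \<open>H\<close> is the exponential generating function of the sequence
  \<open>\<chi>\<^sub>m(K\<^sub>0,-1), \<chi>\<^sub>m(K\<^sub>1,-1), \<dots>\<close> indexed from 1, and Lagrange inversion of \<open>X + H\<close> gives
  the formula, because \<open>B\<^sub>N\<^sub>,\<^sub>k\<close> is \<open>N! / k!\<close> times the coefficient of degree \<open>N\<close> in \<open>H\<^sup>k\<close>.\<close>

unbundle fps_syntax

subsection \<open>Bell polynomials as coefficients of powers\<close>

text \<open>The constant term is forced to 0 because Bell polynomials take their arguments from
  index 1 on. Hence the power \<open>egf x ^ k\<close> has no terms below degree
  \<open>k\<close>.\<close>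

definition egf :: "(nat \<Rightarrow> 'a::field_char_0) \<Rightarrow> 'a fps" where
  "egf x = Abs_fps (\<lambda>i. if i = 0 then 0 else x i / fact i)"

lemma egf_nth: "egf x $ i = (if i = 0 then 0 else x i / fact i)"
  by (simp add: egf_def)

lemma finite_weighted_compositions:
  fixes w :: "'i \<Rightarrow> nat"
  assumes "finite I"
  shows "finite {\<alpha> \<in> I \<rightarrow>\<^sub>E (UNIV :: nat set). (\<Sum>i\<in>I. \<alpha> i) = k \<and> (\<Sum>i\<in>I. w i * \<alpha> i) = n}"
proof (rule finite_subset)
  show "{\<alpha> \<in> I \<rightarrow>\<^sub>E (UNIV :: nat set). (\<Sum>i\<in>I. \<alpha> i) = k \<and> (\<Sum>i\<in>I. w i * \<alpha> i) = n} \<subseteq> I \<rightarrow>\<^sub>E {..k}"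
    using assms by (auto simp: PiE_iff intro: extensional_arb member_le_sum)
  show "finite (I \<rightarrow>\<^sub>E {..k})"
    using assms by (intro finite_PiE) auto
qed

text \<open>A form of the multinomial theorem. In the induction on \<open>I\<close> the binomial
  theorem splits off the exponent \<open>d\<close> of the new index; dividing by
  \<open>fact k\<close> turns the binomial coefficient into 1/(d! (k-d)!), so the weights simply
  multiply.\<close>

lemma fps_multinomial_nth:
  fixes y :: "nat \<Rightarrow> 'a::field_char_0"
  assumes "finite I"
  shows "(\<Sum>i\<in>I. fps_const (y i) * fps_X ^ i) ^ k $ n / fact k =
    (\<Sum>\<alpha> \<in> {\<alpha> \<in> I \<rightarrow>\<^sub>E (UNIV :: nat set). (\<Sum>i\<in>I. \<alpha> i) = k \<and> (\<Sum>i\<in>I. i * \<alpha> i) = n}.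
       \<Prod>i\<in>I. y i ^ \<alpha> i / fact (\<alpha> i))"
  using assms
proof (induction I arbitrary: k n rule: finite_induct)
  case empty
  show ?case
    by (cases "k = 0"; cases "n = 0") (auto simp: power_0_left)
next
  case (insert j I)
  define S where "S = (\<lambda>k n. {\<alpha> \<in> I \<rightarrow>\<^sub>E (UNIV :: nat set).
    (\<Sum>i\<in>I. \<alpha> i) = k \<and> (\<Sum>i\<in>I. i * \<alpha> i) = n})"
  define S' where "S' = {\<alpha> \<in> insert j I \<rightarrow>\<^sub>E (UNIV :: nat set).
    (\<Sum>i\<in>insert j I. \<alpha> i) = k \<and> (\<Sum>i\<in>insert j I. i * \<alpha> i) = n}"
  \<comment> \<open>The possible exponents of the new index. The two bounds keep the natural-number
    subtractions \<open>k - d\<close> and \<open>n - j * d\<close> exact.\<close>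
  define D where "D = {d. d \<le> k \<and> j * d \<le> n}"
  define P where "P = (\<Sum>i\<in>I. fps_const (y i) * fps_X ^ i)"
  define w where "w = (\<lambda>\<alpha>. \<Prod>i\<in>I. y i ^ \<alpha> i / fact (\<alpha> i))"
  have fin: "finite D" "finite (S a b)" for a b
    using finite_weighted_compositions[OF insert.hyps(1), where w = "\<lambda>i. i"]
    by (auto simp: D_def S_def)
  have IH: "(P ^ a) $ b / fact a = sum w (S a b)" for a b
    using insert.IH[of a b] by (simp add: P_def S_def w_def)
  have "(\<Sum>i\<in>insert j I. fps_const (y i) * fps_X ^ i) ^ k $ n / fact k =
      (fps_const (y j) * fps_X ^ j + P) ^ k $ n / fact k"
    using insert.hyps by (simp add: P_def)
  also have "\<dots> = (\<Sum>d\<le>k. of_nat (k choose d) * ((fps_X ^ (j * d) * (fps_const (y j ^ d) * P ^ (k - d))) $ n)) / fact k"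
    unfolding binomial_ring fps_sum_nth
    by (intro arg_cong2[where f = "(/)"] sum.cong refl)
       (simp add: power_mult_distrib mult_ac flip: fps_of_nat power_mult)
  also have "\<dots> = (\<Sum>d\<le>k. if j * d \<le> n then y j ^ d / fact d * ((P ^ (k - d)) $ (n - j * d) / fact (k - d)) else 0)"
    unfolding sum_divide_distrib
    by (intro sum.cong refl) (auto simp: fps_X_power_mult_nth binomial_fact field_simps)
  also have "\<dots> = (\<Sum>d\<in>D. y j ^ d / fact d * sum w (S (k - d) (n - j * d)))"
    unfolding IH by (subst sum.inter_filter[symmetric]) (auto simp: D_def intro!: sum.cong)
  also have "\<dots> = (\<Sum>(d, \<beta>) \<in> (SIGMA d:D. S (k - d) (n - j * d)). y j ^ d / fact d * w \<beta>)"
    using fin by (simp add: sum_distrib_left sum.Sigma)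
  also have "\<dots> = (\<Sum>\<alpha>\<in>S'. \<Prod>i\<in>insert j I. y i ^ \<alpha> i / fact (\<alpha> i))"
  \<comment> \<open>A pair is merged by letting \<open>\<beta>\<close> take the value
    \<open>d\<close> at \<open>j\<close>; resetting that value to \<open>undefined\<close> makes the
    map extensional on \<open>I\<close> again.\<close>
  proof (rule sum.reindex_bij_witness[where i = "\<lambda>\<alpha>. (\<alpha> j, \<alpha>(j := undefined))"
        and j = "\<lambda>(d, \<beta>). \<beta>(j := d)"], goal_cases)
    case (1 a)
    thus ?case using insert.hyps by (auto simp: S_def PiE_iff extensional_def fun_eq_iff)
  next
    case (2 a)
    then obtain d \<beta> where a: "a = (d, \<beta>)" "d \<in> D" "\<beta> \<in> S (k - d) (n - j * d)" by auto
    have "(\<Sum>i\<in>I. (\<beta>(j := d)) i) = sum \<beta> I" "(\<Sum>i\<in>I. i * (\<beta>(j := d)) i) = (\<Sum>i\<in>I. i * \<beta> i)"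
      using insert.hyps by (auto intro!: sum.cong)
    thus ?case using a insert.hyps
      by (auto simp: S_def S'_def D_def PiE_iff extensional_def)
  next
    case (3 \<alpha>)
    thus ?case by auto
  next
    case (4 \<alpha>)
    have "(\<Sum>i\<in>I. (\<alpha>(j := undefined)) i) = sum \<alpha> I"
      "(\<Sum>i\<in>I. i * (\<alpha>(j := undefined)) i) = (\<Sum>i\<in>I. i * \<alpha> i)"
      using insert.hyps by (auto intro!: sum.cong)
    thus ?case using 4 insert.hyps
      by (auto simp: S_def S'_def D_def PiE_iff extensional_def)
  next
    case (5 a)
    then obtain d \<beta> where a: "a = (d, \<beta>)" by (cases a)
    have "(\<Prod>i\<in>I. y i ^ (\<beta>(j := d)) i / fact ((\<beta>(j := d)) i)) = w \<beta>"
      unfolding w_def using insert.hyps by (intro prod.cong) auto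
    thus ?case using a insert.hyps by simp
  qed
  finally show ?case by (simp add: S'_def)
qed

lemma fps_power_nth_cong:
  fixes f g :: "'a::comm_ring_1 fps"
  assumes "\<And>i. i \<le> n \<Longrightarrow> f $ i = g $ i"
  shows "f ^ k $ n = g ^ k $ n"
  using assms
proof (induction k arbitrary: n)
  case (Suc k)
  thus ?case by (auto simp: fps_mult_nth intro!: sum.cong)
qed simp

text \<open>In \<open>f ^ k $ n\<close> every factor contributes at least 1 to the total degree \<open>n\<close>.\<close>

lemma fps_power_nth_cong_zero:
  fixes f g :: "'a::idom fps"
  assumes "f $ 0 = 0" "g $ 0 = 0" "\<And>i. i \<le> n + 1 - k \<Longrightarrow> f $ i = g $ i"
  shows "f ^ k $ n = g ^ k $ n"
proof (cases "k \<le> n")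
  case True
  have shift: "h ^ k $ n = fps_shift 1 h ^ k $ (n - k)" if "h $ 0 = 0" for h :: "'a fps"
  proof -
    have "h = fps_X * fps_shift 1 h"
      using that by (auto simp: fps_eq_iff)
    hence "h ^ k = fps_X ^ k * fps_shift 1 h ^ k"
      by (metis power_mult_distrib)
    thus ?thesis using True by (simp add: fps_X_power_mult_nth)
  qed
  show ?thesis
    unfolding shift[OF assms(1)] shift[OF assms(2)]
    using True assms(3) by (intro fps_power_nth_cong) auto
next
  case False
  thus ?thesis using assms by (simp add: startsby_zero_power_prefix)
qed

text \<open>The defining sum is the multinomial expansion of \<open>P ^ k\<close>, where
  \<open>P\<close> is \<open>egf x\<close> cut off after degree n + 1 - k. The terms cut off cannot
  reach degree \<open>n\<close>, since the other k - 1 factors contribute at least 1 each.\<close>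

lemma bell_poly_eq_egf_power:
  "bell_poly n k x = fact n / fact k * (egf x ^ k $ n)"
proof -
  define I where "I = {1..n + 1 - k}"
  define P where "P = (\<Sum>i\<in>I. fps_const (x i / fact i) * fps_X ^ i)"
  have fin: "finite I" by (simp add: I_def)
  have P_nth: "P $ i = (if i \<in> I then x i / fact i else 0)" for i
    unfolding P_def fps_sum_nth by (simp add: I_def if_distrib cong: if_cong)
  have "bell_poly n k x = fact n * (P ^ k $ n / fact k)"
    unfolding P_def fps_multinomial_nth[OF fin] sum_distrib_left bell_poly_def I_def[symmetric]
    by (intro sum.cong refl) (simp add: prod_dividef)
  also have "P ^ k $ n = egf x ^ k $ n"
    by (rule fps_power_nth_cong_zero) (auto simp: P_nth egf_nth I_def)
  finally show ?thesis by simp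
qed

subsection \<open>Lagrange inversion\<close>

definition phi_deriv :: "'a::comm_semiring_1 fps \<Rightarrow> 'a fps \<Rightarrow> 'a fps" where
  "phi_deriv \<phi> f = \<phi> * fps_deriv f"

text \<open>\<open>H\<close> is divisible by X^2, so \<open>H ^ K\<close> is divisible by X^(2K).
  With N = j + K this makes the terms of the Lagrange sum vanish as soon as K > j, so that sum is
  finite.\<close>

lemma fps_mult_power_nth_eq_0:
  fixes H g :: "'a::idom fps"
  assumes "H $ 0 = 0" "H $ 1 = 0" "N < 2 * K"
  shows "(H ^ K * g) $ N = 0"
proof -
  have "H = fps_X ^ 2 * fps_shift 2 H"
  proof (rule fps_ext)
    fix i show "H $ i = (fps_X ^ 2 * fps_shift 2 H) $ i"
      using assms(1,2) by (cases i; cases "i - 1") (auto simp: fps_X_power_mult_nth)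
  qed
  hence "H ^ K * g = fps_X ^ (2 * K) * (fps_shift 2 H ^ K * g)"
    by (metis power_mult_distrib power_mult mult.assoc)
  thus ?thesis using assms(3) by (simp only: fps_X_power_mult_nth if_True)
qed

text \<open>Lagrange inversion for \<open>X + H\<close>, in the form of a statement about the operator
  \<open>\<phi> D = d / d(X + H)\<close>. The induction absorbs the innermost application of that operator
  into \<open>f\<close>; both sides then telescope by the product rule.\<close>

lemma phi_deriv_power_nth_0:
  fixes \<phi> H f :: "'a::field_char_0 fps"
  assumes H: "H $ 0 = 0" "H $ 1 = 0" and inv: "\<phi> * (1 + fps_deriv H) = 1"
    and K: "j < K"
  shows "((phi_deriv \<phi> ^^ Suc j) f) $ 0 =
    (\<Sum>k<K. (-1) ^ k / fact k * (fact (j + k) * ((H ^ k * fps_deriv f) $ (j + k))))"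
  using K
proof (induction j arbitrary: f)
  case 0
  have "\<phi> $ 0 = 1"
    using arg_cong[OF inv, of "\<lambda>F. F $ 0"] H by simp
  have "(\<Sum>k<K. (-1) ^ k / fact k * (fact (0 + k) * ((H ^ k * fps_deriv f) $ (0 + k)))) =
      (\<Sum>k\<in>{0}. (-1) ^ k / fact k * (fact (0 + k) * ((H ^ k * fps_deriv f) $ (0 + k))))"
    using 0 H by (intro sum.mono_neutral_right) (auto simp: fps_mult_power_nth_eq_0)
  thus ?case using \<open>\<phi> $ 0 = 1\<close> by (simp add: phi_deriv_def)
next
  case (Suc j)
  define h where "h = phi_deriv \<phi> f"
  \<comment> \<open>This is the constant term of the \<open>N\<close>-th derivative of
    \<open>F\<close>, so lowering the index by one costs one differentiation.\<close>
  define c where "c = (\<lambda>N F. fact N * (F :: 'a fps) $ N)"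
  have c_Suc: "c (Suc N) F = c N (fps_deriv F)" for N F
    by (simp add: c_def)
  have c_add: "c N (F + G) = c N F + c N G" for N F G
    by (simp add: c_def algebra_simps)
  have c_const: "c N (of_nat a * F) = of_nat a * c N F" for N a F
    by (simp add: c_def flip: fps_of_nat)
  have f: "fps_deriv f = h + fps_deriv H * h"
  proof -
    have "h + fps_deriv H * h = \<phi> * (1 + fps_deriv H) * fps_deriv f"
      by (simp add: h_def phi_deriv_def algebra_simps)
    thus ?thesis by (simp add: inv)
  qed
  \<comment> \<open>Insert f' = h + H' h and apply the product rule to \<open>H ^ k * h\<close>. The
    surplus term containing the derivative of \<open>H ^ k\<close> yields \<open>u k\<close>; the
    one containing H^k H' h yields \<open>- u (Suc k)\<close>, because (H^(k+1))' = (k+1) H^k H' and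
    k + 1 cancels against the factorial.\<close>
  define u where "u = (\<lambda>k. (-1) ^ k / fact k * c (j + k) (fps_deriv (H ^ k) * h))"
  have "(-1) ^ k / fact k * c (Suc j + k) (H ^ k * fps_deriv f) =
      (-1) ^ k / fact k * c (j + k) (H ^ k * fps_deriv h) + (u k - u (Suc k))" for k
  proof -
    have "fps_deriv (H ^ Suc k) * h = of_nat (Suc k) * (H ^ k * (fps_deriv H * h))"
      by (subst fps_deriv_power) (simp add: algebra_simps del: of_nat_Suc flip: fps_of_nat)
    hence "c (Suc j + k) (fps_deriv (H ^ Suc k) * h) =
        of_nat (Suc k) * c (Suc j + k) (H ^ k * (fps_deriv H * h))"
      by (simp only: c_const)
    hence "u (Suc k) = - ((-1) ^ k / fact k * c (Suc j + k) (H ^ k * (fps_deriv H * h)))"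
      by (simp add: u_def field_simps del: of_nat_Suc power_Suc) (simp add: power_Suc)
    moreover have "c (Suc j + k) (H ^ k * fps_deriv f) =
        c (j + k) (H ^ k * fps_deriv h) + c (j + k) (fps_deriv (H ^ k) * h)
          + c (Suc j + k) (H ^ k * (fps_deriv H * h))"
      by (simp add: f distrib_left c_add c_Suc)
    ultimately show ?thesis
      by (simp add: u_def distrib_left)
  qed
  hence "(\<Sum>k<K. (-1) ^ k / fact k * c (Suc j + k) (H ^ k * fps_deriv f)) =
      (\<Sum>k<K. (-1) ^ k / fact k * c (j + k) (H ^ k * fps_deriv h)) + (\<Sum>k<K. u k - u (Suc k))"
    by (simp add: sum.distrib)
  also have "(\<Sum>k<K. u k - u (Suc k)) = u 0 - u K"
    by (rule sum_lessThan_telescope')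
  also have "u 0 = 0"
    by (simp add: u_def c_def)
  \<comment> \<open>The product rule gives two terms with the factor \<open>H ^ K\<close>, in
    degrees at most j + K + 1. This is below 2K exactly because \<open>Suc j < K\<close>, so both
    vanish.\<close>
  also have "u K = 0"
  proof -
    have "c (j + K) (fps_deriv (H ^ K) * h) = c (Suc (j + K)) (H ^ K * h) - c (j + K) (H ^ K * fps_deriv h)"
      by (simp add: c_Suc c_add)
    also have "\<dots> = 0"
      using H Suc.prems unfolding c_def by (simp add: fps_mult_power_nth_eq_0 del: fact_Suc)
    finally have "c (j + K) (fps_deriv (H ^ K) * h) = 0" .
    thus ?thesis by (simp add: u_def)
  qed
  also have "(\<Sum>k<K. (-1) ^ k / fact k * c (j + k) (H ^ k * fps_deriv h)) =
      ((phi_deriv \<phi> ^^ Suc j) h) $ 0"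
    using Suc.IH[of h] Suc.prems by (simp add: c_def)
  finally show ?case
    by (simp add: c_def h_def funpow_swap1)
qed

subsection \<open>Degree-chromatic polynomials of complete graphs\<close>

definition trunc_exp :: "nat \<Rightarrow> 'a::field_char_0 fps" where
  "trunc_exp m = Abs_fps (\<lambda>i. if i \<le> m then 1 / fact i else 0)"

lemma trunc_exp_nth: "trunc_exp m $ i = (if i \<le> m then 1 / fact i else 0)"
  by (simp add: trunc_exp_def)

lemma trunc_exp_eq_egf: "trunc_exp m = 1 + egf (ones_upto m)"
  by (rule fps_ext) (auto simp: trunc_exp_nth egf_nth ones_upto_def)

text \<open>In a complete graph the neighbours coloured like \<open>v\<close> form the colour class
  of \<open>v\<close> without \<open>v\<close>, so the degree condition bounds class sizes. A
  general vertex set \<open>S\<close> lets an induction delete a whole class.\<close>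

definition capped_colorings :: "nat \<Rightarrow> 'a set \<Rightarrow> nat \<Rightarrow> ('a \<Rightarrow> nat) set" where
  "capped_colorings m S l = {c \<in> S \<rightarrow>\<^sub>E {1..l}. \<forall>j\<in>{1..l}. card {v \<in> S. c v = j} \<le> m}"

lemma finite_capped_colorings: "finite S \<Longrightarrow> finite (capped_colorings m S l)"
  unfolding capped_colorings_def
  by (rule finite_subset[of _ "S \<rightarrow>\<^sub>E {1..l}"]) (auto intro: finite_PiE)

lemma sum_Pow_card:
  fixes g :: "nat \<Rightarrow> 'a::comm_semiring_1"
  assumes "finite S"
  shows "(\<Sum>A\<in>Pow S. g (card A)) = (\<Sum>j\<le>card S. of_nat (card S choose j) * g j)"
proof -
  have "(\<Sum>A\<in>Pow S. g (card A)) = (\<Sum>j\<le>card S. \<Sum>A\<in>{A \<in> Pow S. card A = j}. g (card A))"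
    using assms by (intro sum.group[symmetric]) (auto intro: card_mono)
  also have "\<dots> = (\<Sum>j\<le>card S. of_nat (card S choose j) * g j)"
    using n_subsets[OF assms] by (intro sum.cong) auto
  finally show ?thesis .
qed

text \<open>A colouring amounts to the class \<open>A\<close> of the last colour together with a
  colouring of \<open>S - A\<close> by the first \<open>l\<close> colours. Summing over the size of
  \<open>A\<close> gives a binomial convolution, that is, one more factor
  \<open>trunc_exp m\<close>.\<close>

lemma card_capped_colorings:
  assumes "finite S"
  shows "real (card (capped_colorings m S l)) = fact (card S) * (trunc_exp m ^ l $ card S)"
  using assms
proof (induction l arbitrary: S)
  case 0
  show ?case
    using 0 by (cases "S = {}") (auto simp: capped_colorings_def card_gt_0_iff PiE_eq_empty_iff)
next
  case (Suc l)
  define P where "P = {A \<in> Pow S. card A \<le> m}"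
  have fin: "finite P" "\<And>A. A \<in> P \<Longrightarrow> finite A"
    using Suc.prems by (auto simp: P_def intro: finite_subset)
  have "bij_betw (\<lambda>c. ({v \<in> S. c v = Suc l}, restrict c {v \<in> S. c v \<noteq> Suc l}))
      (capped_colorings m S (Suc l)) (SIGMA A:P. capped_colorings m (S - A) l)"
  proof (rule bij_betw_byWitness[where f' = "\<lambda>(A, d) v. if v \<in> A then Suc l else d v"], goal_cases)
    case 1
    show ?case by (auto simp: capped_colorings_def PiE_iff extensional_def fun_eq_iff)
  next
    case 2
    show ?case
    proof (clarify, goal_cases)
      case (1 A d)
      have "A \<subseteq> S" and d: "d \<in> (S - A) \<rightarrow>\<^sub>E {1..l}"
        using 1 by (simp_all add: P_def capped_colorings_def)
      moreover have "d v \<noteq> Suc l" if "v \<in> S - A" for v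
        using PiE_mem[OF d that] by simp
      ultimately have eq: "{v \<in> S. (if v \<in> A then Suc l else d v) = Suc l} = A"
        "{v \<in> S. (if v \<in> A then Suc l else d v) \<noteq> Suc l} = S - A"
        by auto
      show ?case
        unfolding eq using d by (auto simp: PiE_iff extensional_def fun_eq_iff)
    qed
  next
    case 3
    show ?case
    proof (rule image_subsetI)
      fix c assume c: "c \<in> capped_colorings m S (Suc l)"
      define A where "A = {v \<in> S. c v = Suc l}"
      have SA: "S - A = {v \<in> S. c v \<noteq> Suc l}" by (auto simp: A_def)
      have "{v \<in> S - A. restrict c (S - A) v = j} = {v \<in> S. c v = j}" if "j \<in> {1..l}" for j
        using that by (auto simp: A_def)
      moreover have "c v \<in> {1..l}" if "v \<in> S - A" for v
      proof -
        have "c v \<in> {1..Suc l}" "c v \<noteq> Suc l"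
          using c that by (auto simp: capped_colorings_def A_def)
        thus ?thesis by auto
      qed
      ultimately have "restrict c (S - A) \<in> capped_colorings m (S - A) l"
        using c by (auto simp: capped_colorings_def)
      moreover have "A \<in> P"
        using c by (auto simp: P_def A_def capped_colorings_def)
      ultimately show "({v \<in> S. c v = Suc l}, restrict c {v \<in> S. c v \<noteq> Suc l})
          \<in> (SIGMA A:P. capped_colorings m (S - A) l)"
        by (simp add: SA[symmetric] A_def[symmetric])
    qed
  next
    case 4
    show ?case
    proof (clarify, goal_cases)
      case (1 _ A d)
      define c where "c = (\<lambda>v. if v \<in> A then Suc l else d v)"
      have A: "A \<subseteq> S" "card A \<le> m" and d: "d \<in> capped_colorings m (S - A) l"
        using 1 by (auto simp: P_def)
      have dl: "d v \<in> {1..l}" if "v \<in> S - A" for v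
        using d that by (auto simp: capped_colorings_def)
      have "c v = Suc l \<longleftrightarrow> v \<in> A" if "v \<in> S" for v
        using dl[of v] that by (auto simp: c_def)
      hence "{v \<in> S. c v = Suc l} = A"
        using A by auto
      moreover have "{v \<in> S. c v = j} = {v \<in> S - A. d v = j}" if "j \<in> {1..l}" for j
        using that by (auto simp: c_def)
      ultimately have "card {v \<in> S. c v = j} \<le> m" if "j \<in> {1..Suc l}" for j
        using that A d by (cases "j = Suc l") (auto simp: capped_colorings_def)
      moreover have "c \<in> S \<rightarrow>\<^sub>E {1..Suc l}"
        using A dl d by (force simp: c_def capped_colorings_def PiE_iff extensional_def)
      ultimately show ?case
        by (simp add: capped_colorings_def c_def)
    qed
  qed
  hence "card (capped_colorings m S (Suc l)) = card (SIGMA A:P. capped_colorings m (S - A) l)"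
    by (rule bij_betw_same_card)
  also have "\<dots> = (\<Sum>A\<in>P. card (capped_colorings m (S - A) l))"
    using fin Suc.prems by (intro card_SigmaI) (auto intro: finite_capped_colorings)
  finally have "card (capped_colorings m S (Suc l)) =
    (\<Sum>A\<in>P. card (capped_colorings m (S - A) l))" .
  moreover have "real (card (capped_colorings m (S - A) l)) =
      fact (card S - card A) * (trunc_exp m ^ l $ (card S - card A))" if "A \<in> P" for A
  proof -
    have "card (S - A) = card S - card A"
      using that by (intro card_Diff_subset fin(2)) (simp_all add: P_def)
    thus ?thesis using Suc.IH[of "S - A"] Suc.prems by simp
  qed
  ultimately have "real (card (capped_colorings m S (Suc l))) =
      (\<Sum>A\<in>P. fact (card S - card A) * (trunc_exp m ^ l $ (card S - card A)))"
    by simp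
  also have "\<dots> = (\<Sum>A\<in>Pow S. if card A \<le> m
      then fact (card S - card A) * (trunc_exp m ^ l $ (card S - card A)) else 0)"
    unfolding P_def using Suc.prems by (intro sum.inter_filter) auto
  also have "\<dots> = (\<Sum>j\<le>card S. of_nat (card S choose j) * (if j \<le> m
      then fact (card S - j) * (trunc_exp m ^ l $ (card S - j)) else 0))"
    by (rule sum_Pow_card[OF Suc.prems])
  also have "\<dots> = fact (card S) * (trunc_exp m ^ Suc l $ card S)"
    unfolding power_Suc fps_mult_nth atLeast0AtMost sum_distrib_left
    by (intro sum.cong refl) (simp add: trunc_exp_nth binomial_fact)
  finally show ?case .
qed

text \<open>Since m >= 1, a class of size a satisfies a - 1 <= m - 1 iff a <= m, even with truncated
  subtraction. Passing from vertices to colours adds only empty classes.\<close>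

lemma degree_colorings_complete_graph:
  assumes "m \<ge> 1"
  shows "degree_colorings m (complete_graph s) l = capped_colorings m {1..s} l"
proof -
  have "card {u \<in> neighbors (complete_graph s) v. c u = c v} \<le> m - 1 \<longleftrightarrow>
      card {u \<in> {1..s}. c u = c v} \<le> m" if "v \<in> {1..s}" for c :: "nat \<Rightarrow> nat" and v
  proof -
    have "neighbors (complete_graph s) v = {1..s} - {v}"
      using that by (fastforce simp: neighbors_def complete_graph_def doubleton_eq_iff)
    hence "{u \<in> neighbors (complete_graph s) v. c u = c v} = {u \<in> {1..s}. c u = c v} - {v}"
      by auto
    moreover have "card ({u \<in> {1..s}. c u = c v} - {v}) = card {u \<in> {1..s}. c u = c v} - 1"
      using that by (intro card_Diff_singleton) auto
    ultimately have "card {u \<in> neighbors (complete_graph s) v. c u = c v} =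
        card {u \<in> {1..s}. c u = c v} - 1"
      by simp
    thus ?thesis using assms by linarith
  qed
  moreover have "(\<forall>v\<in>{1..s}. card {u \<in> {1..s}. c u = c v} \<le> m) \<longleftrightarrow>
      (\<forall>j\<in>{1..l}. card {u \<in> {1..s}. c u = j} \<le> m)" if "c \<in> {1..s} \<rightarrow>\<^sub>E {1..l}" for c
  proof (intro iffI ballI)
    fix j assume *: "\<forall>v\<in>{1..s}. card {u \<in> {1..s}. c u = c v} \<le> m"
    show "card {u \<in> {1..s}. c u = j} \<le> m"
    proof (cases "{u \<in> {1..s}. c u = j} = {}")
      case True
      thus ?thesis by (simp only: card.empty)
    next
      case False
      thus ?thesis using * by auto
    qed
  qed (use that in auto)
  ultimately show ?thesis
    by (auto simp: degree_colorings_def capped_colorings_def complete_graph_def)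
qed

text \<open>Expanding (1 + psi)^l binomially shows that the count depends on \<open>l\<close> only
  through the binomials (l choose k), which are polynomials in \<open>l\<close>. A polynomial is
  fixed by its values at the positive integers, so the formula holds at every real \<open>x\<close>,
  in particular at -1.\<close>

lemma degree_chromatic_poly_complete_graph:
  assumes "m \<ge> 1"
  shows "poly (degree_chromatic_poly m (complete_graph s)) x =
    (\<Sum>k=0..s. (x gchoose k) * (fact k * bell_poly s k (ones_upto m)))"
proof -
  define q :: "nat \<Rightarrow> real poly" where
    "q = (\<lambda>k. smult (1 / fact k) (\<Prod>i=0..<k. [:- of_nat i, 1:]))"
  have q: "poly (q k) y = y gchoose k" for k y
    by (simp add: q_def gbinomial_prod_rev poly_prod)
  define p where "p = (\<Sum>k=0..s. smult (fact k * bell_poly s k (ones_upto m)) (q k))"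
  have p: "poly p y = (\<Sum>k=0..s. (y gchoose k) * (fact k * bell_poly s k (ones_upto m)))" for y
    by (simp add: p_def poly_sum q mult.commute)
  have count: "poly p (real l) = real (card (degree_colorings m (complete_graph s) l))" for l
  proof -
    define \<psi> :: "real fps" where "\<psi> = egf (ones_upto m)"
    have "real (card (degree_colorings m (complete_graph s) l)) = fact s * ((\<psi> + 1) ^ l $ s)"
      using card_capped_colorings[of "{1..s}" m l] assms
      by (simp add: degree_colorings_complete_graph trunc_exp_eq_egf \<psi>_def add.commute)
    also have "(\<psi> + 1) ^ l $ s = (\<Sum>k\<le>l. of_nat (l choose k) * (\<psi> ^ k $ s))"
      unfolding binomial_ring fps_sum_nth by (simp flip: fps_of_nat)
    \<comment> \<open>A common range for both cutoffs: the binomial vanishes for k > l, and the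
      coefficient of \<open>\<psi> ^ k\<close> vanishes for k > s.\<close>
    also have "\<dots> = (\<Sum>k\<le>l + s. of_nat (l choose k) * (\<psi> ^ k $ s))"
      by (intro sum.mono_neutral_left) auto
    also have "\<dots> = (\<Sum>k=0..s. of_nat (l choose k) * (\<psi> ^ k $ s))"
      by (intro sum.mono_neutral_right)
        (auto simp: \<psi>_def egf_nth startsby_zero_power_prefix)
    also have "fact s * \<dots> = poly p (real l)"
      unfolding p sum_distrib_left
      by (intro sum.cong refl) (simp add: bell_poly_eq_egf_power \<psi>_def binomial_gbinomial)
    finally show ?thesis by simp
  qed
  have "degree_chromatic_poly m (complete_graph s) = p"
    unfolding degree_chromatic_poly_def
  proof (rule the_equality)
    fix p' :: "real poly"
    assume p': "\<forall>l::nat. l \<ge> 1 \<longrightarrow>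
      poly p' (real l) = real (card (degree_colorings m (complete_graph s) l))"
    have "real ` {1..} \<subseteq> {z. poly (p' - p) z = 0}"
      using p' count by auto
    moreover have "infinite (real ` {1..})"
      by (simp add: finite_image_iff infinite_Ici)
    ultimately have "infinite {z. poly (p' - p) z = 0}"
      using finite_subset by blast
    thus "p' = p"
      using poly_roots_finite[of "p' - p"] by auto
  qed (use count in auto)
  thus ?thesis by (simp add: p)
qed

lemma chi_complete_eq_bell:
  assumes "m \<ge> 1" "s \<ge> 1"
  shows "chi_complete m s = (\<Sum>k=1..s. (-1) ^ k * fact k * bell_poly s k (ones_upto m))"
proof -
  have "(-1 gchoose k) = (-1 :: real) ^ k" for k
    using gbinomial_minus[of "1 :: real" k] by (simp add: binomial_gbinomial[symmetric])
  hence "chi_complete m s = (\<Sum>k=0..s. (-1) ^ k * fact k * bell_poly s k (ones_upto m))"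
    using assms by (simp add: chi_complete_def degree_chromatic_poly_complete_graph mult.assoc)
  also have "\<dots> = (\<Sum>k=1..s. (-1) ^ k * fact k * bell_poly s k (ones_upto m))"
    using assms by (subst sum.atLeast_Suc_atMost) (auto simp: bell_poly_eq_egf_power)
  finally show ?thesis .
qed

text \<open>By \<open>chi_complete_eq_bell\<close> the values at -1 are the coefficients of the
  geometric series for 1/(1 + psi). Differentiation undoes the index shift \<open>i - 1\<close>, and
  the summand 1 restores the constant term that the convention for K_0 sets to 0.\<close>

lemma trunc_exp_mult_deriv_chi:
  assumes "m \<ge> 1"
  shows "trunc_exp m * (1 + fps_deriv (egf (\<lambda>i. chi_complete m (i - 1)))) = 1"
proof (rule fps_ext)
  fix n
  define \<psi> :: "real fps" where "\<psi> = egf (ones_upto m)"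
  define Q where "Q = 1 + fps_deriv (egf (\<lambda>i. chi_complete m (i - 1)))"
  have \<psi>0: "(- \<psi>) $ 0 = 0" by (simp add: \<psi>_def egf_nth)
  \<comment> \<open>Up to degree \<open>n\<close> a finite geometric sum suffices: the error
    \<open>(- \<psi>) ^ Suc n\<close> starts beyond degree \<open>n\<close>.\<close>
  have Q: "Q $ s = (\<Sum>k\<le>n. (- \<psi>) ^ k) $ s" if "s \<le> n" for s
  proof (cases "s = 0")
    case True
    have "(\<Sum>k\<le>n. (- \<psi>) ^ k $ 0) = (\<Sum>k\<in>{0}. (- \<psi>) ^ k $ 0)"
      using \<psi>0 by (intro sum.mono_neutral_right) (auto simp: fps_power_zeroth)
    thus ?thesis using True by (simp add: Q_def egf_nth chi_complete_def fps_sum_nth)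
  next
    case False
    have "Q $ s = chi_complete m s / fact s"
      using False by (simp add: Q_def egf_nth)
    also have "\<dots> = (\<Sum>k=1..s. (- \<psi>) ^ k $ s)"
    proof -
      have "(- \<psi>) ^ k $ s = (-1) ^ k * (\<psi> ^ k $ s)" for k
        by (cases "even k") auto
      thus ?thesis
        using False assms
        by (simp add: chi_complete_eq_bell sum_divide_distrib bell_poly_eq_egf_power \<psi>_def)
    qed
    also have "\<dots> = (\<Sum>k\<le>n. (- \<psi>) ^ k $ s)"
      using \<psi>0 False that
      by (intro sum.mono_neutral_left) (auto simp: startsby_zero_power_prefix not_le Suc_le_eq)
    finally show ?thesis by (simp add: fps_sum_nth)
  qed
  have "(trunc_exp m * Q) $ n = (trunc_exp m * (\<Sum>k\<le>n. (- \<psi>) ^ k)) $ n"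
    unfolding fps_mult_nth by (intro sum.cong) (auto simp: Q)
  also have "trunc_exp m * (\<Sum>k\<le>n. (- \<psi>) ^ k) = 1 - (- \<psi>) ^ Suc n"
    using one_diff_power_eq[of "- \<psi>" "Suc n"]
    by (simp add: trunc_exp_eq_egf \<psi>_def lessThan_Suc_atMost)
  also have "\<dots> $ n = 1 $ n"
    using startsby_zero_power_prefix[OF \<psi>0, of "Suc n"] by simp
  finally show "(trunc_exp m * (1 + fps_deriv (egf (\<lambda>i. chi_complete m (i - 1))))) $ n = 1 $ n"
    by (simp add: Q_def)
qed

subsection \<open>Increasing trees\<close>

text \<open>Induction along the path from the root, which lies on no cycle since it has no parent. A
  cycle through a later vertex enters it by its unique parent, so it would also pass through that
  parent.\<close>

lemma rooted_tree_acyclic: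
  assumes "rooted_tree V r E"
  shows "acyclic E"
proof -
  have no_cycle: "(x, x) \<notin> E\<^sup>+" if "(r, x) \<in> E\<^sup>*" for x
    using that
  proof (induction rule: rtrancl_induct)
    case base
    show ?case using assms by (auto simp: rooted_tree_def dest: tranclD2)
  next
    case (step y z)
    show ?case
    proof
      assume "(z, z) \<in> E\<^sup>+"
      then obtain w where w: "(z, w) \<in> E\<^sup>*" "(w, z) \<in> E"
        by (auto dest: tranclD2)
      have "z \<in> V - {r}"
        using assms step.hyps(2) by (auto simp: rooted_tree_def)
      hence "w = y"
        using assms step.hyps(2) w(2) unfolding rooted_tree_def by blast
      hence "(y, y) \<in> E\<^sup>+"
        using w step.hyps(2) by (auto intro: rtrancl_into_trancl2)
      thus False using step.IH by simp
    qed
  qed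
  have "x \<in> V" if "(x, x) \<in> E\<^sup>+" for x
    using assms tranclD[OF that] by (auto simp: rooted_tree_def)
  thus ?thesis
    using assms no_cycle unfolding acyclic_def rooted_tree_def by blast
qed

lemma rtrancl_imp_successively:
  assumes "(r, u) \<in> E\<^sup>*"
  shows "\<exists>xs. xs \<noteq> [] \<and> hd xs = r \<and> last xs = u \<and> successively (\<lambda>u v. (u, v) \<in> E) xs"
  using assms
proof (induction rule: rtrancl_induct)
  case base
  show ?case by (rule exI[of _ "[r]"]) auto
next
  case (step y z)
  then obtain xs where "xs \<noteq> []" "hd xs = r" "last xs = y" "successively (\<lambda>u v. (u, v) \<in> E) xs"
    by blast
  thus ?case
    using step.hyps by (intro exI[of _ "xs @ [z]"]) (auto simp: successively_append_iff)
qed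

lemma wf_converse_imp_leaf_path:
  assumes "wf (E\<inverse>)"
  shows "\<exists>xs. root_leaf_path v E xs"
  using assms
proof (induction v rule: wf_induct_rule)
  case (less v)
  show ?case
  proof (cases "children E v = {}")
    case True
    thus ?thesis by (intro exI[of _ "[v]"]) (auto simp: root_leaf_path_def)
  next
    case False
    then obtain w where w: "(v, w) \<in> E" by (auto simp: children_def)
    then obtain xs where "root_leaf_path w E xs" using less by blast
    thus ?thesis using w
      by (intro exI[of _ "v # xs"]) (auto simp: root_leaf_path_def successively_Cons)
  qed
qed

text \<open>The definition constrains only complete root-leaf paths, so the edge is embedded in one:
  a path from the root to \<open>u\<close>, followed by a descent from \<open>v\<close> to a leaf.
  The descent ends because \<open>E\<close> is finite and acyclic.\<close>

lemma increasing_tree_edge_less: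
  assumes "increasing_tree n r E" "(u, v) \<in> E"
  shows "u < v"
proof -
  have tree: "rooted_tree {1..n} r E"
    using assms by (simp add: increasing_tree_def)
  hence EV: "E \<subseteq> {1..n} \<times> {1..n}" and "(r, u) \<in> E\<^sup>*"
    using assms(2) by (auto simp: rooted_tree_def)
  then obtain xs where xs: "xs \<noteq> []" "hd xs = r" "last xs = u"
      "successively (\<lambda>u v. (u, v) \<in> E) xs"
    using rtrancl_imp_successively by metis
  have "finite E" using EV finite_subset by blast
  hence "wf (E\<inverse>)"
    using rooted_tree_acyclic[OF tree] by (rule finite_acyclic_wf_converse)
  from wf_converse_imp_leaf_path[OF this, of v]
  obtain ys where ys: "root_leaf_path v E ys" ..
  have "root_leaf_path r E (xs @ ys)"
    using xs ys assms(2) by (simp add: root_leaf_path_def successively_append_iff)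
  hence "sorted_wrt (<) (xs @ ys)"
    using assms(1) by (auto simp: increasing_tree_def)
  moreover have "u \<in> set xs" "v \<in> set ys"
    using xs ys by (auto simp: root_leaf_path_def)
  ultimately show "u < v"
    by (auto simp: sorted_wrt_append)
qed

section \<open>Encoding increasing trees by their parent maps\<close>

definition parent_maps :: "nat \<Rightarrow> (nat \<Rightarrow> nat) set" where
  "parent_maps n = (\<Pi>\<^sub>E v\<in>{2..n}. {1..<v})"

definition parent_edges :: "nat \<Rightarrow> (nat \<Rightarrow> nat) \<Rightarrow> (nat \<times> nat) set" where
  "parent_edges n p = {(p v, v) |v. v \<in> {2..n}}"

lemma children_parent_edges: "children (parent_edges n p) u = {v \<in> {2..n}. p v = u}"
  by (auto simp: children_def parent_edges_def)

lemma finite_parent_maps: "finite (parent_maps n)"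
  by (simp add: parent_maps_def finite_PiE)

lemma parent_maps_less:
  assumes "p \<in> parent_maps n" "v \<in> {2..n}"
  shows "1 \<le> p v" "p v < v"
  using assms by (auto simp: parent_maps_def dest!: PiE_mem)

lemma increasing_tree_parent_edges:
  assumes "p \<in> parent_maps n" "n \<ge> 1"
  shows "increasing_tree n 1 (parent_edges n p)"
proof -
  note p = parent_maps_less[OF assms(1)]
  have reach: "(1, v) \<in> (parent_edges n p)\<^sup>*" if "v \<in> {1..n}" for v
    using that
  proof (induction v rule: less_induct)
    case (less v)
    show ?case
    proof (cases "v = 1")
      case False
      hence v: "v \<in> {2..n}" using less.prems by auto
      have "(1, p v) \<in> (parent_edges n p)\<^sup>*"
        using p[OF v] v by (intro less.IH) auto
      moreover have "(p v, v) \<in> parent_edges n p"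
        using v by (auto simp: parent_edges_def)
      ultimately show ?thesis by (rule rtrancl_into_rtrancl)
    qed auto
  qed
  have sub: "parent_edges n p \<subseteq> {1..n} \<times> {1..n}"
    using p by (fastforce simp: parent_edges_def)
  have uniq: "\<exists>!u. (u, v) \<in> parent_edges n p" if "v \<in> {1..n} - {1}" for v
    using that by (auto simp: parent_edges_def)
  have "rooted_tree {1..n} 1 (parent_edges n p)"
    unfolding rooted_tree_def using reach sub uniq assms(2) by (auto simp: parent_edges_def)
  moreover have "sorted_wrt (<) xs" if "root_leaf_path 1 (parent_edges n p) xs" for xs
  proof -
    have "successively (<) xs"
      using that p unfolding root_leaf_path_def
      by (auto simp: parent_edges_def elim!: successively_mono)
    thus ?thesis
      by (simp add: successively_conv_sorted_wrt)
  qed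
  ultimately show ?thesis by (simp add: increasing_tree_def)
qed

text \<open>The root must be 1, since otherwise 1 would have a parent with a smaller label. Every
  other vertex has a unique, smaller parent, which defines the map; conversely, following parents
  downwards always ends at 1.\<close>

lemma increasing_trees_eq_image_parent_maps:
  assumes "n \<ge> 1"
  shows "{(r, E). increasing_tree n r E} = (\<lambda>p. (1, parent_edges n p)) ` parent_maps n"
proof (intro equalityI subsetI)
  fix t assume "t \<in> {(r, E). increasing_tree n r E}"
  then obtain r E where t: "t = (r, E)" and tree: "increasing_tree n r E" by auto
  note less = increasing_tree_edge_less[OF tree]
  have EV: "E \<subseteq> {1..n} \<times> {1..n}" and r: "r \<in> {1..n}" "\<And>u. (u, r) \<notin> E"
    and uniq: "\<And>v. v \<in> {1..n} - {r} \<Longrightarrow> \<exists>!u. (u, v) \<in> E"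
    using tree by (auto simp: increasing_tree_def rooted_tree_def)
  have "r = 1"
  proof (rule ccontr)
    assume "r \<noteq> 1"
    then obtain u where "(u, 1) \<in> E" using uniq[of 1] assms by auto
    thus False using less[of u 1] EV by auto
  qed
  define p where "p = (\<lambda>v\<in>{2..n}. THE u. (u, v) \<in> E)"
  have p: "(u, v) \<in> E \<longleftrightarrow> u = p v" if "v \<in> {2..n}" for u v
  proof -
    have "\<exists>!u. (u, v) \<in> E" using uniq[of v] that \<open>r = 1\<close> by auto
    moreover from theI'[OF this] have "(p v, v) \<in> E"
      using that by (simp add: p_def)
    ultimately show ?thesis by blast
  qed
  have "p \<in> parent_maps n"
    unfolding parent_maps_def
  proof (intro PiE_I)
    fix v assume v: "v \<in> {2..n}"
    hence "(p v, v) \<in> E" using p by auto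
    thus "p v \<in> {1..<v}" using less EV by auto
  qed (auto simp: p_def)
  moreover have "E = parent_edges n p"
  proof (intro set_eqI iffI; clarify)
    fix u v assume uv: "(u, v) \<in> E"
    have "v \<noteq> 1" using uv r \<open>r = 1\<close> by auto
    hence "v \<in> {2..n}" using uv EV by auto
    thus "(u, v) \<in> parent_edges n p" using p uv by (auto simp: parent_edges_def)
  next
    fix u v assume "(u, v) \<in> parent_edges n p"
    thus "(u, v) \<in> E" using p by (auto simp: parent_edges_def)
  qed
  ultimately show "t \<in> (\<lambda>p. (1, parent_edges n p)) ` parent_maps n"
    using t \<open>r = 1\<close> by auto
qed (use increasing_tree_parent_edges assms in auto)

lemma inj_on_parent_edges: "inj_on (parent_edges n) (parent_maps n)"
proof (rule inj_onI)
  fix p q assume *: "p \<in> parent_maps n" "q \<in> parent_maps n" "parent_edges n p = parent_edges n q"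
  have "p v = q v" if "v \<in> {2..n}" for v
  proof -
    have "(p v, v) \<in> parent_edges n q"
      using that unfolding *(3)[symmetric] by (auto simp: parent_edges_def)
    thus ?thesis by (auto simp: parent_edges_def)
  qed
  thus "p = q"
    using * unfolding parent_maps_def by (intro PiE_ext) auto
qed

lemma num_mary_increasing_trees_eq_card_parent_maps:
  assumes "n \<ge> 1"
  shows "num_mary_increasing_trees m n =
    card {p \<in> parent_maps n. \<forall>v\<in>{1..n}. card {w \<in> {2..n}. p w = v} \<le> m}"
proof -
  let ?P = "{p \<in> parent_maps n. \<forall>v\<in>{1..n}. card {w \<in> {2..n}. p w = v} \<le> m}"
  have "{(r, E). increasing_tree n r E \<and> mary_tree m {1..n} E} =
      {(r, E). increasing_tree n r E} \<inter> {(r, E). mary_tree m {1..n} E}"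
    by auto
  also have "\<dots> = (\<lambda>p. (1, parent_edges n p)) ` ?P"
    unfolding increasing_trees_eq_image_parent_maps[OF assms]
    by (auto simp: mary_tree_def children_parent_edges)
  finally show ?thesis
    unfolding num_mary_increasing_trees_def
    using inj_on_parent_edges[of n] by (simp add: card_image inj_on_def)
qed

section \<open>Tree weights and the operator \<open>phi_deriv\<close>\<close>

lemma fps_deriv_prod:
  fixes f :: "'i \<Rightarrow> 'a::comm_ring_1 fps"
  assumes "finite A"
  shows "fps_deriv (prod f A) = (\<Sum>u\<in>A. fps_deriv (f u) * prod f (A - {u}))"
  using assms
proof (induction A rule: finite_induct)
  case (insert a A)
  have "(\<Sum>u\<in>A. fps_deriv (f u) * prod f (insert a A - {u})) =
      (\<Sum>u\<in>A. f a * (fps_deriv (f u) * prod f (A - {u})))"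
  proof (intro sum.cong refl)
    fix u assume "u \<in> A"
    hence "insert a A - {u} = insert a (A - {u})" using insert.hyps by auto
    thus "fps_deriv (f u) * prod f (insert a A - {u}) = f a * (fps_deriv (f u) * prod f (A - {u}))"
      using insert.hyps by (simp add: mult_ac)
  qed
  thus ?case
    using insert by (simp add: sum_distrib_left mult_ac add.commute)
qed simp

text \<open>Attaching the new largest vertex to \<open>u\<close> differentiates the factor of \<open>u\<close> once more and
  contributes a fresh factor \<open>\<phi>\<close>, so by the product rule growing a tree in all possible ways
  is an application of \<open>\<phi> D\<close>.\<close>

lemma sum_parent_maps_weight:
  fixes \<phi> :: "'a::comm_ring_1 fps"
  assumes "n \<ge> 1"
  shows "(\<Sum>p\<in>parent_maps n. \<Prod>v\<in>{1..n}. fps_nth_deriv (card {w \<in> {2..n}. p w = v}) \<phi>) =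
    (phi_deriv \<phi> ^^ n) fps_X"
  using assms
proof (induction n rule: nat_induct_at_least)
  case base
  show ?case by (simp add: parent_maps_def phi_deriv_def)
next
  case (Suc n)
  define d where "d = (\<lambda>n (p :: nat \<Rightarrow> nat) v. card {w \<in> {2..n}. p w = v})"
  have ins: "{2..Suc n} = insert (Suc n) {2..n}"
    using Suc.hyps by auto
  define F where "F = (\<lambda>k. fps_nth_deriv k \<phi>)"
  have F_Suc: "F (Suc k) = fps_deriv (F k)" for k
    unfolding F_def by (rule fps_nth_deriv_commute)
  have weight: "(\<Prod>v\<in>{1..Suc n}. F (d (Suc n) (p(Suc n := u)) v)) =
      \<phi> * (fps_deriv (F (d n p u)) * (\<Prod>v\<in>{1..n} - {u}. F (d n p v)))"
    if p: "p \<in> parent_maps n" and u: "u \<in> {1..n}" for p u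
  proof -
    have set: "{w \<in> {2..Suc n}. (p(Suc n := u)) w = v} =
        (if v = u then insert (Suc n) {w \<in> {2..n}. p w = v} else {w \<in> {2..n}. p w = v})" for v
      unfolding ins by auto
    have d: "d (Suc n) (p(Suc n := u)) v = (if v = u then Suc (d n p v) else d n p v)" for v
      unfolding d_def set by simp
    \<comment> \<open>The new vertex starts as a leaf, so its factor is \<open>\<phi>\<close>
      itself.\<close>
    have "{w \<in> {2..n}. p w = Suc n} = {}"
      using parent_maps_less(2)[OF p] by fastforce
    hence new: "d n p (Suc n) = 0" by (simp add: d_def)
    have "(\<Prod>v\<in>{1..Suc n}. F (d (Suc n) (p(Suc n := u)) v)) =
        F (d (Suc n) (p(Suc n := u)) (Suc n)) * (\<Prod>v\<in>{1..n}. F (d (Suc n) (p(Suc n := u)) v))"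
      by (simp add: atLeastAtMostSuc_conv mult.commute)
    also have "F (d (Suc n) (p(Suc n := u)) (Suc n)) = \<phi>"
      using u by (auto simp: d new F_def)
    also have "(\<Prod>v\<in>{1..n}. F (d (Suc n) (p(Suc n := u)) v)) =
        F (Suc (d n p u)) * (\<Prod>v\<in>{1..n} - {u}. F (d (Suc n) (p(Suc n := u)) v))"
      using u by (subst prod.remove[of _ u]) (auto simp: d)
    also have "(\<Prod>v\<in>{1..n} - {u}. F (d (Suc n) (p(Suc n := u)) v)) = (\<Prod>v\<in>{1..n} - {u}. F (d n p v))"
      by (intro prod.cong) (auto simp: d)
    finally show ?thesis by (simp only: F_Suc)
  qed
  have inj: "inj_on (\<lambda>(u, p). p(Suc n := u)) ({1..n} \<times> parent_maps n)"
    using inj_combinator[of "Suc n" "{2..n}" "\<lambda>v. {1..<v}"]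
    by (simp add: parent_maps_def atLeastLessThanSuc_atLeastAtMost)
  have PM: "parent_maps (Suc n) = (\<lambda>(u, p). p(Suc n := u)) ` ({1..n} \<times> parent_maps n)"
    unfolding parent_maps_def ins PiE_insert_eq by (simp add: atLeastLessThanSuc_atLeastAtMost)
  have "(\<Sum>p\<in>parent_maps (Suc n). \<Prod>v\<in>{1..Suc n}. F (d (Suc n) p v)) =
      (\<Sum>(u, p)\<in>{1..n} \<times> parent_maps n. \<Prod>v\<in>{1..Suc n}. F (d (Suc n) (p(Suc n := u)) v))"
    unfolding PM sum.reindex[OF inj] by (simp add: case_prod_unfold)
  also have "\<dots> = (\<Sum>(u, p)\<in>{1..n} \<times> parent_maps n.
      \<phi> * (fps_deriv (F (d n p u)) * (\<Prod>v\<in>{1..n} - {u}. F (d n p v))))"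
    by (intro sum.cong refl) (auto simp only: weight mem_Times_iff fst_conv snd_conv split: prod.splits)
  also have "\<dots> = (\<Sum>p\<in>parent_maps n. \<Sum>u\<in>{1..n}.
      \<phi> * (fps_deriv (F (d n p u)) * (\<Prod>v\<in>{1..n} - {u}. F (d n p v))))"
    unfolding sum.cartesian_product[symmetric] by (rule sum.swap)
  also have "\<dots> = \<phi> * (\<Sum>p\<in>parent_maps n. fps_deriv (\<Prod>v\<in>{1..n}. F (d n p v)))"
    by (simp add: fps_deriv_prod sum_distrib_left)
  also have "\<dots> = phi_deriv \<phi> (\<Sum>p\<in>parent_maps n. \<Prod>v\<in>{1..n}. F (d n p v))"
    by (simp add: phi_deriv_def fps_deriv_sum)
  also have "\<dots> = (phi_deriv \<phi> ^^ Suc n) fps_X"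
    using Suc.IH by (simp add: F_def d_def)
  finally show ?case by (simp add: F_def d_def)
qed

lemma prod_fps_nth_0: "prod f A $ 0 = (\<Prod>i\<in>A. (f i :: 'a::comm_ring_1 fps) $ 0)"
  by (induction A rule: infinite_finite_induct) simp_all

text \<open>The derivative of \<open>trunc_exp m\<close> of order c has constant term 1 if c <= m
  and 0 otherwise. The constant term of a tree's weight is therefore the indicator of being
  m-ary.\<close>

lemma num_mary_increasing_trees_eq_phi_deriv:
  assumes "n \<ge> 1"
  shows "real (num_mary_increasing_trees m n) = (phi_deriv (trunc_exp m) ^^ n) fps_X $ 0"
proof -
  have "(phi_deriv (trunc_exp m :: real fps) ^^ n) fps_X $ 0 =
      (\<Sum>p\<in>parent_maps n. \<Prod>v\<in>{1..n}. if card {w \<in> {2..n}. p w = v} \<le> m then 1 else 0)"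
    unfolding sum_parent_maps_weight[OF assms, symmetric] fps_sum_nth prod_fps_nth_0
    by (intro sum.cong prod.cong refl) (simp add: fps_deriv_maclauren_0 trunc_exp_nth)
  also have "\<dots> = (\<Sum>p\<in>parent_maps n. if \<forall>v\<in>{1..n}. card {w \<in> {2..n}. p w = v} \<le> m then 1 else 0)"
    by (intro sum.cong refl) (auto intro!: prod.neutral)
  also have "\<dots> = (\<Sum>p\<in>{p \<in> parent_maps n. \<forall>v\<in>{1..n}. card {w \<in> {2..n}. p w = v} \<le> m}. 1)"
    by (rule sum.inter_filter[symmetric, OF finite_parent_maps])
  also have "\<dots> = real (num_mary_increasing_trees m n)"
    unfolding num_mary_increasing_trees_eq_card_parent_maps[OF assms] by simp
  finally show ?thesis ..
qed

theorem theorem1: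
  fixes m n :: nat
  assumes "m \<ge> 1" and "n \<ge> 1"
  shows "real (num_mary_increasing_trees m n) =
           (\<Sum>k=0..n. (-1) ^ k * bell_poly (n + k - 1) k (\<lambda>i. chi_complete m (i - 1)))
       \<and> chi_complete m 0 = 0
       \<and> (\<forall>s\<ge>1. chi_complete m s = (\<Sum>k=1..s. (-1) ^ k * fact k * bell_poly s k (ones_upto m)))"
proof (intro conjI allI impI)
  \<comment> \<open>The convention for K_0 gives \<open>H $ 1 = 0\<close>, the order condition of
    Lagrange inversion. It is applied to \<open>fps_X\<close>, whose derivative is 1, with j = n - 1
    and cutoff n + 1, so that j + k = n + k - 1.\<close>
  define H where "H = egf (\<lambda>i. chi_complete m (i - 1))"
  obtain j where n: "n = Suc j" using assms(2) by (cases n) auto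
  have "real (num_mary_increasing_trees m n) = (phi_deriv (trunc_exp m) ^^ Suc j) fps_X $ 0"
    using num_mary_increasing_trees_eq_phi_deriv[OF assms(2)] by (simp only: n)
  also have "\<dots> = (\<Sum>k<Suc n. (-1) ^ k / fact k * (fact (j + k) * ((H ^ k * fps_deriv fps_X) $ (j + k))))"
  proof (rule phi_deriv_power_nth_0)
    show "trunc_exp m * (1 + fps_deriv H) = 1"
      unfolding H_def by (rule trunc_exp_mult_deriv_chi[OF assms(1)])
  qed (auto simp: H_def egf_nth chi_complete_def n)
  also have "\<dots> = (\<Sum>k=0..n. (-1) ^ k * bell_poly (n + k - 1) k (\<lambda>i. chi_complete m (i - 1)))"
    unfolding lessThan_Suc_atMost atLeast0AtMost
    by (intro sum.cong refl) (simp add: bell_poly_eq_egf_power H_def n)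
  finally show "real (num_mary_increasing_trees m n) =
      (\<Sum>k=0..n. (-1) ^ k * bell_poly (n + k - 1) k (\<lambda>i. chi_complete m (i - 1)))" .
next
  show "chi_complete m 0 = 0" by (simp add: chi_complete_def)
next
  fix s :: nat assume "s \<ge> 1"
  thus "chi_complete m s = (\<Sum>k=1..s. (-1) ^ k * fact k * bell_poly s k (ones_upto m))"
    by (rule chi_complete_eq_bell[OF assms(1)])
qed

end
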